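(* Let $F$ be a finite commutative semifield with $|F|=q$. Then there exists a colored $q$-configuration with $q^2$ points and $q^2$ lines.
   Context: A semifield is a set $S$ with operations $+$ and $\cdot$ such that $(S,+)$ is a group with identity $0$; for $a,b\in S$ with $a\ne0$ there are unique $x,y\in S$ with $a\cdot x=b$ and $y\cdot a=b$; both distributive laws $a(b+c)=ab+ac$, $(a+b)c=ac+bc$ hold; and there is $1\ne0$ with $1\cdot a=a\cdot1=a$ for all $a$ (multiplication need not be associative). It is commutative if $a\cdot b=b\cdot a$ for all $a,b$. A $k$-configuration consists of finite sets $P$ (points), $L$ (lines) and an incidence relation $R\subseteq P\times L$ such that: (i) there do not exist distinct $p_1,p_2\in P$ and distinct $l_1,l_2\in L$ with $(p_i,l_j)\in R$ for all $i,j$; (ii) each point is incident with exactly $k$ lines; (iii) each line is incident with exactly $k$ points. Its incidence graph has vertex set $P\sqcup L$ and an edge $\{p,l\}$ for each $(p,l)\in R$; the configuration is connected if this graph is. A $k$-edge coloring assigns one of $k$ colors to each edge so that edges sharing a vertex have distinct colors; $\phi_c(v)$ is the neighbor of $v$ along the edge of color $c$. The 6-cycle property: for every vertex $v$ and distinct colors $a,b,c$, $(\phi_c\phi_b\phi_a\phi_c\phi_b\phi_a)(v)=v$. A colored $k$-configuration is a connected $k$-configuration with a $k$-edge coloring of its incidence graph having the 6-cycle property. *)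

theory Defs
  imports "HOL-Algebra.Ring" "Graph_Theory.Graph_Theory"
begin

text \<open>Only the signature of ring records is used here: multiplication is not assumed
  associative, and addition is not assumed commutative.\<close>

locale semifield =
  fixes S :: "('a, 'm) ring_scheme" (structure)
  assumes add_group: "group (add_monoid S)"
    and m_closed: "\<lbrakk>a \<in> carrier S; b \<in> carrier S\<rbrakk> \<Longrightarrow> a \<otimes> b \<in> carrier S"
    and left_division: "\<lbrakk>a \<in> carrier S; b \<in> carrier S; a \<noteq> \<zero>\<rbrakk> \<Longrightarrow>
      \<exists>!x. x \<in> carrier S \<and> a \<otimes> x = b"
    and right_division: "\<lbrakk>a \<in> carrier S; b \<in> carrier S; a \<noteq> \<zero>\<rbrakk> \<Longrightarrow>
      \<exists>!y. y \<in> carrier S \<and> y \<otimes> a = b"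
    and l_distrib: "\<lbrakk>a \<in> carrier S; b \<in> carrier S; c \<in> carrier S\<rbrakk> \<Longrightarrow>
      a \<otimes> (b \<oplus> c) = a \<otimes> b \<oplus> a \<otimes> c"
    and r_distrib: "\<lbrakk>a \<in> carrier S; b \<in> carrier S; c \<in> carrier S\<rbrakk> \<Longrightarrow>
      (a \<oplus> b) \<otimes> c = a \<otimes> c \<oplus> b \<otimes> c"
    and one_closed: "\<one> \<in> carrier S"
    and one_not_zero: "\<one> \<noteq> \<zero>"
    and l_one: "a \<in> carrier S \<Longrightarrow> \<one> \<otimes> a = a"
    and r_one: "a \<in> carrier S \<Longrightarrow> a \<otimes> \<one> = a"

locale commutative_semifield = semifield +
  assumes m_comm: "\<lbrakk>a \<in> carrier S; b \<in> carrier S\<rbrakk> \<Longrightarrow> a \<otimes> b = b \<otimes> a"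

locale configuration =
  fixes k :: nat and P :: "'p set" and L :: "'l set" and R :: "('p \<times> 'l) set"
  assumes finite_points: "finite P"
    and finite_lines: "finite L"
    and incidence: "R \<subseteq> P \<times> L"
    and no_digon: "\<not> (\<exists>p\<^sub>1\<in>P. \<exists>p\<^sub>2\<in>P. \<exists>l\<^sub>1\<in>L. \<exists>l\<^sub>2\<in>L. p\<^sub>1 \<noteq> p\<^sub>2 \<and> l\<^sub>1 \<noteq> l\<^sub>2 \<and>
      (p\<^sub>1, l\<^sub>1) \<in> R \<and> (p\<^sub>1, l\<^sub>2) \<in> R \<and> (p\<^sub>2, l\<^sub>1) \<in> R \<and> (p\<^sub>2, l\<^sub>2) \<in> R)"
    and lines_per_point: "p \<in> P \<Longrightarrow> card {l \<in> L. (p, l) \<in> R} = k"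
    and points_per_line: "l \<in> L \<Longrightarrow> card {p \<in> P. (p, l) \<in> R} = k"

definition incidence_edges :: "('p \<times> 'l) set \<Rightarrow> ('p + 'l) set set" where
  "incidence_edges R = {{Inl p, Inr l} | p l. (p, l) \<in> R}"

text \<open>An undirected edge is represented by the two opposite arcs between its endpoints.\<close>

definition incidence_graph ::
    "'p set \<Rightarrow> 'l set \<Rightarrow> ('p \<times> 'l) set \<Rightarrow> ('p + 'l) pair_pre_digraph" where
  "incidence_graph P L R =
    \<lparr> pverts = P <+> L, parcs = {(u, v). {u, v} \<in> incidence_edges R} \<rparr>"

locale connected_configuration = configuration +
  assumes connected: "connected (with_proj (incidence_graph P L R))"

definition edge_coloring :: "nat \<Rightarrow> 'v set set \<Rightarrow> ('v set \<Rightarrow> nat) \<Rightarrow> bool" where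
  "edge_coloring k E c \<longleftrightarrow>
    (\<forall>e\<in>E. c e < k) \<and> (\<forall>e\<in>E. \<forall>f\<in>E. e \<noteq> f \<and> e \<inter> f \<noteq> {} \<longrightarrow> c e \<noteq> c f)"

text \<open>In a \<open>k\<close>-edge-colored \<open>k\<close>-regular graph every vertex is on exactly one edge of each
  color below \<open>k\<close>, so the description below is proper there.\<close>

definition color_neighbor :: "'v set set \<Rightarrow> ('v set \<Rightarrow> nat) \<Rightarrow> nat \<Rightarrow> 'v \<Rightarrow> 'v" where
  "color_neighbor E c a v = (THE w. {v, w} \<in> E \<and> c {v, w} = a)"

definition six_cycle_property :: "nat \<Rightarrow> 'v set \<Rightarrow> 'v set set \<Rightarrow> ('v set \<Rightarrow> nat) \<Rightarrow> bool" where
  "six_cycle_property k V E c \<longleftrightarrow>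
    (\<forall>v\<in>V. \<forall>i<k. \<forall>j<k. \<forall>m<k. i \<noteq> j \<and> j \<noteq> m \<and> i \<noteq> m \<longrightarrow>
      (let \<phi> = color_neighbor E c in \<phi> m (\<phi> j (\<phi> i (\<phi> m (\<phi> j (\<phi> i v))))) = v))"

locale colored_configuration = connected_configuration k P L R
  for k :: nat and P :: "'p set" and L :: "'l set" and R :: "('p \<times> 'l) set" +
  fixes c :: "('p + 'l) set \<Rightarrow> nat"
  assumes coloring: "edge_coloring k (incidence_edges R) c"
    and six_cycle: "six_cycle_property k (P <+> L) (incidence_edges R) c"

end

theory Submission
  imports Defs
begin

no_notation vwalk_join (infixr \<open>\<oplus>\<close> 65)

text \<open>Points and lines are both given coordinates in \<open>F \<times> F\<close>: the point \<open>(x, y)\<close> lies on the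
  line \<open>(m, b)\<close> iff \<open>y + b = x m\<close>, and that edge has color \<open>x + m\<close>. As multiplication is
  commutative, the rule is symmetric in points and lines, so following color \<open>a\<close> is the same
  involution \<open>(x, y) \<mapsto> (a - x, x (a - x) - y)\<close> on either side. Following the colors \<open>a\<close>, \<open>b\<close>, \<open>c\<close>
  in turn leads from \<open>(x, y)\<close> to \<open>(z, x z + (b - a) (c - b) - y)\<close>, where \<open>z = a - b + c - x\<close>.
  Again by commutativity this is symmetric in \<open>a\<close> and \<open>c\<close>, which is the 6-cycle property.\<close>

section \<open>Additive group and sign rules of a semifield\<close>

context semifield
begin

lemma add_comm:
  assumes a: "a \<in> carrier S" and b: "b \<in> carrier S"
  shows "a \<oplus> b = b \<oplus> a"
proof -
  interpret A: group "add_monoid S" by (rule add_group)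
  have cl: "\<And>u v. u \<in> carrier S \<Longrightarrow> v \<in> carrier S \<Longrightarrow> u \<oplus> v \<in> carrier S"
    using A.m_closed by simp
  have assoc: "\<And>u v w. u \<in> carrier S \<Longrightarrow> v \<in> carrier S \<Longrightarrow> w \<in> carrier S \<Longrightarrow>
      u \<oplus> v \<oplus> w = u \<oplus> (v \<oplus> w)"
    using A.m_assoc by simp
  have lc: "\<And>u v w. u \<in> carrier S \<Longrightarrow> v \<in> carrier S \<Longrightarrow> w \<in> carrier S \<Longrightarrow>
      u \<oplus> v = u \<oplus> w \<Longrightarrow> v = w"
    using A.Units_l_cancel A.Units_eq by simp
  have rc: "\<And>u v w. u \<in> carrier S \<Longrightarrow> v \<in> carrier S \<Longrightarrow> w \<in> carrier S \<Longrightarrow>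
      v \<oplus> u = w \<oplus> u \<Longrightarrow> v = w"
    using A.right_cancel by simp
  \<comment> \<open>Expand \<open>(a + b) (1 + 1)\<close> with either distributive law.\<close>
  have "(a \<oplus> b) \<otimes> (\<one> \<oplus> \<one>) = (a \<oplus> b) \<oplus> (a \<oplus> b)"
    using a b by (simp add: l_distrib r_one one_closed cl)
  moreover have "(a \<oplus> b) \<otimes> (\<one> \<oplus> \<one>) = (a \<oplus> a) \<oplus> (b \<oplus> b)"
    using r_distrib[of a b "\<one> \<oplus> \<one>"] a b by (simp add: l_distrib r_one one_closed cl)
  ultimately have "a \<oplus> (b \<oplus> a \<oplus> b) = a \<oplus> (a \<oplus> b \<oplus> b)"
    using a b by (simp add: assoc cl)
  then have "b \<oplus> a \<oplus> b = a \<oplus> b \<oplus> b" by (rule lc[rotated -1]) (simp_all add: a b cl)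
  then show ?thesis using rc[of b "b \<oplus> a" "a \<oplus> b"] a b cl by simp
qed

sublocale abelian_group S
proof -
  interpret A: group "add_monoid S" by (rule add_group)
  show "abelian_group S"
    using A.m_closed A.one_closed A.m_assoc A.l_one A.r_one A.l_inv_ex add_comm
    by (intro abelian_groupI) auto
qed

lemma zero_mult: "a \<in> carrier S \<Longrightarrow> \<zero> \<otimes> a = \<zero>"
  using r_distrib[of \<zero> \<zero> a] add.r_cancel_one'[of "\<zero> \<otimes> a" "\<zero> \<otimes> a"] m_closed by simp

lemma mult_zero: "a \<in> carrier S \<Longrightarrow> a \<otimes> \<zero> = \<zero>"
  using l_distrib[of a \<zero> \<zero>] add.r_cancel_one'[of "a \<otimes> \<zero>" "a \<otimes> \<zero>"] m_closed by simp

lemma minus_mult: "\<lbrakk>a \<in> carrier S; b \<in> carrier S\<rbrakk> \<Longrightarrow> (\<ominus> a) \<otimes> b = \<ominus> (a \<otimes> b)"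
  using r_distrib[of "\<ominus> a" a b] by (simp add: l_neg zero_mult minus_equality m_closed)

lemma mult_minus: "\<lbrakk>a \<in> carrier S; b \<in> carrier S\<rbrakk> \<Longrightarrow> a \<otimes> (\<ominus> b) = \<ominus> (a \<otimes> b)"
  using l_distrib[of a "\<ominus> b" b] by (simp add: l_neg mult_zero minus_equality m_closed)

lemma mult_left_cancel:
  "\<lbrakk>a \<in> carrier S; b \<in> carrier S; c \<in> carrier S; a \<noteq> \<zero>; a \<otimes> b = a \<otimes> c\<rbrakk> \<Longrightarrow> b = c"
  using left_division[of a "a \<otimes> c"] m_closed by blast

end

section \<open>Incidence and color involutions on the coordinate plane\<close>

context commutative_semifield
begin

definition incident :: "'a \<times> 'a \<Rightarrow> 'a \<times> 'a \<Rightarrow> bool" where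
  "incident u v \<longleftrightarrow> snd u \<oplus> snd v = fst u \<otimes> fst v"

definition across :: "'a \<Rightarrow> 'a \<times> 'a \<Rightarrow> 'a \<times> 'a" where
  "across a u = (a \<ominus> fst u, fst u \<otimes> (a \<ominus> fst u) \<ominus> snd u)"

abbreviation plane :: "('a \<times> 'a) set" where
  "plane \<equiv> carrier S \<times> carrier S"

lemma incident_commute: "\<lbrakk>u \<in> plane; v \<in> plane\<rbrakk> \<Longrightarrow> incident u v \<longleftrightarrow> incident v u"
  unfolding incident_def by (auto simp: a_comm m_comm)

lemma across_closed: "\<lbrakk>a \<in> carrier S; u \<in> plane\<rbrakk> \<Longrightarrow> across a u \<in> plane"
  by (auto simp: across_def m_closed)

text \<open>Used throughout to turn incidence and color conditions into explicit
  coordinates.\<close>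

lemma add_eq_iff: "\<lbrakk>a \<in> carrier S; b \<in> carrier S; c \<in> carrier S\<rbrakk> \<Longrightarrow>
    a \<oplus> b = c \<longleftrightarrow> b = c \<ominus> a"
  by (metis a_minus_def a_closed a_comm a_inv_closed add.m_assoc add.inv_solve_right)

lemma add_diff_add_left:
  assumes "a \<in> carrier S" "b \<in> carrier S" "c \<in> carrier S"
  shows "(a \<oplus> b) \<ominus> (a \<oplus> c) = b \<ominus> c"
proof -
  have "c \<oplus> (b \<ominus> c) = b"
    using add_eq_iff[of c "b \<ominus> c" b] assms by simp
  then have "a \<oplus> c \<oplus> (b \<ominus> c) = a \<oplus> b"
    using assms by (simp add: a_assoc)
  then show ?thesis
    using add_eq_iff[of "a \<oplus> c" "b \<ominus> c" "a \<oplus> b"] assms by simp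
qed

text \<open>The color fixes the first coordinate of \<open>v\<close>, and incidence then fixes the
  second. So \<open>u\<close> has exactly one neighbor of each color.\<close>

lemma across_iff:
  assumes "a \<in> carrier S" "u \<in> plane" "v \<in> plane"
  shows "incident u v \<and> fst u \<oplus> fst v = a \<longleftrightarrow> v = across a u"
  using assms by (cases u; cases v) (auto simp: incident_def across_def add_eq_iff m_closed)

lemma across_involution:
  assumes "a \<in> carrier S" "u \<in> plane"
  shows "across a (across a u) = u"
proof -
  have "incident u (across a u) \<and> fst u \<oplus> fst (across a u) = a"
    using across_iff[of a u "across a u"] across_closed assms by blast
  then have "incident (across a u) u \<and> fst (across a u) \<oplus> fst u = a"
    using across_closed[OF assms] incident_commute[of u "across a u"] assms
    by (auto simp: a_comm)
  then show ?thesis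
    using across_iff[of a "across a u" u] across_closed assms by simp
qed

lemma across_three:
  assumes abc: "a \<in> carrier S" "b \<in> carrier S" "c \<in> carrier S" and u: "(x, y) \<in> plane"
  defines "z \<equiv> a \<ominus> b \<oplus> c \<ominus> x"
  shows "across c (across b (across a (x, y))) =
    (z, x \<otimes> z \<oplus> (b \<ominus> a) \<otimes> (c \<ominus> b) \<ominus> y)"
proof -
  \<comment> \<open>Writing the colors as \<open>x + m\<close>, \<open>x + m + v\<close> and
    \<open>x + m + v + w\<close> makes the path explicit. Its first coordinates are
    \<open>x\<close>, \<open>m\<close>, \<open>x + v\<close>, \<open>m + w\<close>, and its second
    coordinates start with \<open>y\<close>, \<open>x m - y\<close>, \<open>v m + y\<close>.\<close>
  define m where "m = a \<ominus> x"
  define v where "v = b \<ominus> a"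
  define w where "w = c \<ominus> b"
  have x: "x \<in> carrier S" and y: "y \<in> carrier S" using u by auto
  have m: "m \<in> carrier S" and v: "v \<in> carrier S" and w: "w \<in> carrier S"
    using abc x by (auto simp: m_def v_def w_def)
  have a: "a = x \<oplus> m"
    using add_eq_iff[of x m a] abc x m by (simp add: m_def)
  have b: "b = x \<oplus> m \<oplus> v"
    using add_eq_iff[of a v b] abc v by (simp add: v_def flip: a)
  have c: "c = x \<oplus> m \<oplus> v \<oplus> w"
    using add_eq_iff[of b w c] abc w by (simp add: w_def flip: b)
  note cl = x y m v w m_closed
  have z: "z = m \<oplus> w"
  proof -
    have "a \<ominus> b \<oplus> c = a \<oplus> w"
      using abc cl by (simp add: w_def a_minus_def a_ac)
    also have "\<dots> = x \<oplus> (m \<oplus> w)"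
      using cl by (simp add: a a_assoc)
    finally show ?thesis
      using add_eq_iff[of x "m \<oplus> w" "x \<oplus> (m \<oplus> w)"] cl by (simp add: z_def)
  qed
  have "b \<ominus> m = x \<oplus> v"
    using cl add_eq_iff[of m "x \<oplus> v" b] abc by (simp add: b a_ac)
  moreover have "m \<otimes> (x \<oplus> v) \<ominus> (x \<otimes> m \<ominus> y) = v \<otimes> m \<oplus> y"
    using cl by (simp add: l_distrib m_comm[of m] a_minus_def minus_add a_ac r_neg r_neg1 r_neg2)
  moreover have "c \<ominus> (x \<oplus> v) = m \<oplus> w"
    using cl add_eq_iff[of "x \<oplus> v" "m \<oplus> w" c] abc by (simp add: c a_ac)
  moreover have "(x \<oplus> v) \<otimes> (m \<oplus> w) \<ominus> (v \<otimes> m \<oplus> y) = x \<otimes> (m \<oplus> w) \<oplus> v \<otimes> w \<ominus> y"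
  proof -
    have "(x \<oplus> v) \<otimes> (m \<oplus> w) = v \<otimes> m \<oplus> (x \<otimes> (m \<oplus> w) \<oplus> v \<otimes> w)"
      using cl by (simp add: r_distrib l_distrib a_ac)
    then show ?thesis using cl by (simp add: add_diff_add_left)
  qed
  ultimately show ?thesis
    unfolding z by (simp add: across_def flip: m_def v_def w_def)
qed

lemma across_three_reverse:
  assumes "a \<in> carrier S" "b \<in> carrier S" "c \<in> carrier S" "u \<in> plane"
  shows "across c (across b (across a u)) = across a (across b (across c u))"
proof -
  obtain x y where u: "u = (x, y)" by (cases u)
  have xy: "x \<in> carrier S" "y \<in> carrier S" using assms u by auto
  have "a \<ominus> b \<oplus> c \<ominus> x = c \<ominus> b \<oplus> a \<ominus> x"
    using assms xy by (simp add: a_minus_def a_ac)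
  \<comment> \<open>Both factors change sign, the two signs cancel, and the factors are
    swapped.\<close>
  moreover have "(b \<ominus> a) \<otimes> (c \<ominus> b) = (b \<ominus> c) \<otimes> (a \<ominus> b)"
  proof -
    have "b \<ominus> a = \<ominus> (a \<ominus> b)" "c \<ominus> b = \<ominus> (b \<ominus> c)"
      using assms by (simp_all add: a_minus_def minus_add a_ac)
    then show ?thesis
      using assms by (simp add: minus_mult mult_minus m_closed m_comm)
  qed
  ultimately show ?thesis
    using assms by (simp add: u across_three)
qed

text \<open>Reversing the inner triple by \<open>across_three_reverse\<close> leaves the composite
  \<open>c b a a b c\<close>, which collapses from the middle because each letter is an
  involution.\<close>

lemma across_six_cycle:
  assumes "a \<in> carrier S" "b \<in> carrier S" "c \<in> carrier S" "u \<in> plane"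
  shows "across c (across b (across a (across c (across b (across a u))))) = u"
  using assms
  by (simp add: across_three_reverse[of a b c u] across_involution across_closed)

text \<open>Once \<open>u\<close> and the first coordinate of \<open>v\<close> are known, the
  incidence equation can be solved for the second coordinate.\<close>

lemma incident_fst_inj:
  assumes "u \<in> plane" "v \<in> plane" "v' \<in> plane" "incident u v" "incident u v'" "fst v = fst v'"
  shows "v = v'"
  using assms by (cases u; cases v; cases v') (auto simp: incident_def add_eq_iff m_closed)

text \<open>If \<open>v\<close> and \<open>v'\<close> have different first coordinates
  \<open>m\<close> and \<open>m'\<close>, subtracting the two equations of a common neighbor
  \<open>(x, y)\<close> gives \<open>(m - m') x = b - b'\<close>. This determines \<open>x\<close>
  by cancellation, and \<open>x\<close> determines the neighbor.\<close>

lemma incident_no_digon: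
  assumes p: "u \<in> plane" "u' \<in> plane" "v \<in> plane" "v' \<in> plane"
    and i: "incident u v" "incident u v'" "incident u' v" "incident u' v'"
  shows "u = u' \<or> v = v'"
proof (cases "fst v = fst v'")
  case True
  then show ?thesis using incident_fst_inj[of u v v'] assms by simp
next
  case False
  obtain x y x' y' m b m' b' where
    uv: "u = (x, y)" "u' = (x', y')" "v = (m, b)" "v' = (m', b')"
    by (cases u; cases u'; cases v; cases v')
  note cl = p[unfolded uv, simplified] m_closed
  have e: "y \<oplus> b = x \<otimes> m" "y \<oplus> b' = x \<otimes> m'" "y' \<oplus> b = x' \<otimes> m" "y' \<oplus> b' = x' \<otimes> m'"
    using i by (auto simp: uv incident_def)
  have "(m \<ominus> m') \<otimes> x = b \<ominus> b'"
    using cl e(1,2)[symmetric]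
    by (simp add: m_comm l_distrib mult_minus a_minus_def minus_add a_ac r_neg r_neg1 r_neg2)
  moreover have "(m \<ominus> m') \<otimes> x' = b \<ominus> b'"
    using cl e(3,4)[symmetric]
    by (simp add: m_comm l_distrib mult_minus a_minus_def minus_add a_ac r_neg r_neg1 r_neg2)
  moreover have "m \<ominus> m' \<noteq> \<zero>"
    using False cl add_eq_iff[of m' \<zero> m] by (auto simp: uv)
  ultimately have "fst u = fst u'"
    using mult_left_cancel[of "m \<ominus> m'" x x'] cl by (simp add: uv)
  then show ?thesis
    \<comment> \<open>The same injectivity, now seen from \<open>v\<close> with the two sides
      exchanged.\<close>
    using incident_fst_inj[of v u u'] incident_commute assms by blast
qed

text \<open>Projection to the first coordinate is a bijection: each \<open>m\<close> extends to
  exactly one pair incident with \<open>u\<close>.\<close>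

lemma card_incident:
  assumes "u \<in> plane"
  shows "card {v \<in> plane. incident u v} = card (carrier S)"
proof -
  have "bij_betw fst {v \<in> plane. incident u v} (carrier S)"
  proof (rule bij_betw_imageI)
    show "inj_on fst {v \<in> plane. incident u v}"
      using incident_fst_inj[OF assms] by (auto intro!: inj_onI)
    have "(m, fst u \<otimes> m \<ominus> snd u) \<in> {v \<in> plane. incident u v}" if "m \<in> carrier S" for m
      using assms that by (auto simp: incident_def add_eq_iff m_closed)
    then show "fst ` {v \<in> plane. incident u v} = carrier S"
      by force
  qed
  then show ?thesis by (rule bij_betw_same_card)
qed

end

section \<open>Transport to an arbitrary set of points, with numbers as colors\<close>

locale coordinatized_semifield = commutative_semifield S
  for S :: "('a, 'm) ring_scheme" (structure) +
  fixes P :: "'p set" and coord :: "'p \<Rightarrow> 'a \<times> 'a" and color :: "'a \<Rightarrow> nat"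
  assumes finite_carrier: "finite (carrier S)"
    and coord: "bij_betw coord P plane"
    and color: "bij_betw color (carrier S) {..<card (carrier S)}"
begin

text \<open>One set with one coordinate map serves for both points and lines; the tags
  \<open>Inl\<close> and \<open>Inr\<close> keep the two copies apart in the incidence
  graph.\<close>

definition R :: "('p \<times> 'p) set" where
  "R = {(p, l). p \<in> P \<and> l \<in> P \<and> incident (coord p) (coord l)}"

text \<open>An edge is an unordered pair, but its tags tell which end is the point, so the
  description has a unique solution.\<close>

definition edge_color :: "('p + 'p) set \<Rightarrow> nat" where
  "edge_color e =
    color (THE a. \<exists>p l. e = {Inl p, Inr l} \<and> a = fst (coord p) \<oplus> fst (coord l))"

definition neighbor :: "'a \<Rightarrow> 'p \<Rightarrow> 'p" where
  "neighbor a p = inv_into P coord (across a (coord p))"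

lemma coord_closed: "p \<in> P \<Longrightarrow> coord p \<in> plane"
  using coord by (auto simp: bij_betw_def)

lemma fst_coord_closed: "p \<in> P \<Longrightarrow> fst (coord p) \<in> carrier S"
  using coord_closed by (metis mem_Times_iff)

lemma coord_eq_iff: "\<lbrakk>p \<in> P; l \<in> P\<rbrakk> \<Longrightarrow> coord p = coord l \<longleftrightarrow> p = l"
  using coord by (auto simp: bij_betw_def inj_on_eq_iff)

lemma ex_coord: "u \<in> plane \<Longrightarrow> \<exists>p\<in>P. coord p = u"
  using coord by (metis bij_betw_def imageE)

lemma color_eq_iff: "\<lbrakk>a \<in> carrier S; b \<in> carrier S\<rbrakk> \<Longrightarrow> color a = color b \<longleftrightarrow> a = b"
  using color by (auto simp: bij_betw_def inj_on_eq_iff)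

lemma edge_color_eq: "edge_color {Inl p, Inr l} = color (fst (coord p) \<oplus> fst (coord l))"
  unfolding edge_color_def by (auto simp: doubleton_eq_iff)

lemma edge_iff: "{Inl p, Inr l} \<in> incidence_edges R \<longleftrightarrow> (p, l) \<in> R"
  by (auto simp: incidence_edges_def doubleton_eq_iff)

lemma R_sym: "(p, l) \<in> R \<longleftrightarrow> (l, p) \<in> R"
  using incident_commute[OF coord_closed coord_closed] by (auto simp: R_def)

lemma neighbor_closed: "\<lbrakk>a \<in> carrier S; p \<in> P\<rbrakk> \<Longrightarrow> neighbor a p \<in> P"
  and coord_neighbor: "\<lbrakk>a \<in> carrier S; p \<in> P\<rbrakk> \<Longrightarrow> coord (neighbor a p) = across a (coord p)"
  using coord across_closed[of a "coord p"] coord_closed[of p]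
  by (auto simp: neighbor_def bij_betw_def inv_into_into f_inv_into_f)

lemma neighbor_iff:
  assumes "a \<in> carrier S" "p \<in> P"
  shows "(p, l) \<in> R \<and> color (fst (coord p) \<oplus> fst (coord l)) = color a \<longleftrightarrow> l = neighbor a p"
proof (cases "l \<in> P")
  case True
  have "(p, l) \<in> R \<and> color (fst (coord p) \<oplus> fst (coord l)) = color a \<longleftrightarrow>
      incident (coord p) (coord l) \<and> fst (coord p) \<oplus> fst (coord l) = a"
    using assms True fst_coord_closed by (auto simp: R_def color_eq_iff)
  also have "\<dots> \<longleftrightarrow> coord l = coord (neighbor a p)"
    using assms True coord_closed by (simp add: across_iff coord_neighbor)
  also have "\<dots> \<longleftrightarrow> l = neighbor a p"
    using assms True neighbor_closed coord_eq_iff by blast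
  finally show ?thesis .
next
  case False
  \<comment> \<open>Both sides are false: \<open>R\<close> and \<open>neighbor a\<close> stay inside
    \<open>P\<close>.\<close>
  then show ?thesis using assms neighbor_closed by (auto simp: R_def)
qed

text \<open>Here and on the line side, \<open>neighbor_iff\<close> gives existence and uniqueness
  for the definite description; a \<open>w\<close> with the same tag is excluded because every edge
  has one end of each kind.\<close>

lemma color_neighbor_Inl:
  assumes "a \<in> carrier S" "p \<in> P"
  shows "color_neighbor (incidence_edges R) edge_color (color a) (Inl p) = Inr (neighbor a p)"
proof -
  have "{Inl p, w} \<in> incidence_edges R \<and> edge_color {Inl p, w} = color a \<longleftrightarrow>
      w = Inr (neighbor a p)" for w
  proof (cases w)
    case (Inl l)
    then show ?thesis by (auto simp: incidence_edges_def doubleton_eq_iff)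
  next
    case (Inr l)
    then show ?thesis using neighbor_iff[OF assms] by (simp add: edge_iff edge_color_eq)
  qed
  then show ?thesis by (simp add: color_neighbor_def)
qed

lemma color_neighbor_Inr:
  assumes "a \<in> carrier S" "l \<in> P"
  shows "color_neighbor (incidence_edges R) edge_color (color a) (Inr l) = Inl (neighbor a l)"
proof -
  have "{Inr l, w} \<in> incidence_edges R \<and> edge_color {Inr l, w} = color a \<longleftrightarrow>
      w = Inl (neighbor a l)" for w
  proof (cases w)
    case (Inr p)
    then show ?thesis by (auto simp: incidence_edges_def doubleton_eq_iff)
  next
    case (Inl p)
    have "(l, p) \<in> R \<Longrightarrow> fst (coord p) \<oplus> fst (coord l) = fst (coord l) \<oplus> fst (coord p)"
      using fst_coord_closed by (simp add: R_def a_comm)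
    then show ?thesis using neighbor_iff[OF assms, of p] R_sym[of p l] Inl
      by (auto simp: edge_iff edge_color_eq insert_commute[of "Inr l"])
  qed
  then show ?thesis by (simp add: color_neighbor_def)
qed

lemma neighbor_six_cycle:
  assumes "a \<in> carrier S" "b \<in> carrier S" "c \<in> carrier S" "p \<in> P"
  shows "neighbor c (neighbor b (neighbor a (neighbor c (neighbor b (neighbor a p))))) = p"
  using assms
  by (simp add: coord_neighbor neighbor_closed across_six_cycle coord_closed flip: coord_eq_iff)

lemma six_cycle_edge_color:
  "six_cycle_property (card (carrier S)) (P <+> P) (incidence_edges R) edge_color"
proof -
  let ?\<phi> = "color_neighbor (incidence_edges R) edge_color"
  have "?\<phi> m (?\<phi> j (?\<phi> i (?\<phi> m (?\<phi> j (?\<phi> i v))))) = v"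
    if "v \<in> P <+> P" "i < card (carrier S)" "j < card (carrier S)" "m < card (carrier S)"
    for v i j m
  proof -
    \<comment> \<open>Surjectivity of \<open>color\<close> replaces color numbers by semifield
      elements, on which the involutions are defined.\<close>
    have "\<exists>a\<in>carrier S. n = color a" if "n < card (carrier S)" for n
      using bij_betw_imp_surj_on[OF color] that by (metis imageE lessThan_iff)
    then obtain a b c where "a \<in> carrier S" "i = color a" "b \<in> carrier S" "j = color b"
      "c \<in> carrier S" "m = color c"
      using \<open>i < _\<close> \<open>j < _\<close> \<open>m < _\<close> by meson
    then show ?thesis using that(1)
      by (auto simp: color_neighbor_Inl color_neighbor_Inr neighbor_closed neighbor_six_cycle)
  qed
  then show ?thesis by (simp add: six_cycle_property_def Let_def)
qed

lemma edge_coloring_edge_color: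
  "edge_coloring (card (carrier S)) (incidence_edges R) edge_color"
  unfolding edge_coloring_def
proof (intro conjI ballI impI)
  fix e assume "e \<in> incidence_edges R"
  then obtain p l where "e = {Inl p, Inr l}" "p \<in> P" "l \<in> P"
    by (auto simp: incidence_edges_def R_def)
  then show "edge_color e < card (carrier S)"
    using color fst_coord_closed by (auto simp: edge_color_eq bij_betw_def)
next
  fix e f
  assume e: "e \<in> incidence_edges R" and f: "f \<in> incidence_edges R"
    and ef: "e \<noteq> f \<and> e \<inter> f \<noteq> {}"
  obtain p l where e': "e = {Inl p, Inr l}" "(p, l) \<in> R" "p \<in> P" "l \<in> P"
    using e by (auto simp: incidence_edges_def R_def)
  obtain p' l' where f': "f = {Inl p', Inr l'}" "(p', l') \<in> R" "p' \<in> P" "l' \<in> P"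
    using f by (auto simp: incidence_edges_def R_def)
  show "edge_color e \<noteq> edge_color f"
  proof
    assume eq: "edge_color e = edge_color f"
    \<comment> \<open>The common color of both edges. Either end of an edge is
      \<open>neighbor a\<close> of the other, so edges sharing one end share both.\<close>
    define a where "a = fst (coord p) \<oplus> fst (coord l)"
    have a: "a \<in> carrier S" using e' fst_coord_closed by (simp add: a_def)
    have "l = neighbor a p" "l' = neighbor a p'"
      using neighbor_iff[OF a] e' f' eq by (auto simp: edge_color_eq a_def)
    moreover have "p = neighbor a l" "p' = neighbor a l'"
      using neighbor_iff[OF a] e' f' eq R_sym fst_coord_closed
      by (auto simp: edge_color_eq a_def a_comm)
    ultimately show False using ef e'(1) f'(1) by auto
  qed
qed

section \<open>Connectedness, degrees and assembly of the configuration\<close>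

lemma connected_incidence_graph: "connected (with_proj (incidence_graph P P R))"
proof -
  \<comment> \<open>By definition, \<open>connected\<close> means strong connectedness of this
    symmetric closure. Hence every vertex is linked to the origin in both directions.\<close>
  define G where "G = mk_symmetric (with_proj (incidence_graph P P R))"
  have verts: "pverts G = P <+> P"
    by (simp add: G_def incidence_graph_def)
  interpret pair_wf_digraph G
    by unfold_locales
      (auto simp: G_def parcs_mk_symmetric incidence_graph_def incidence_edges_def
        R_def doubleton_eq_iff)
  have arc: "(Inl p, Inr l) \<in> parcs G" "(Inr l, Inl p) \<in> parcs G" if "(p, l) \<in> R" for p l
    using that edge_iff[of p l]
    by (auto simp: G_def parcs_mk_symmetric incidence_graph_def)
  obtain origin where origin: "origin \<in> P" "coord origin = (\<zero>, \<zero>)"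
    using ex_coord[of "(\<zero>, \<zero>)"] by auto
  \<comment> \<open>The path to the origin is \<open>(x, y)\<close>, \<open>(0, -y)\<close>, \<open>(1, y)\<close>, \<open>(y, 0)\<close>, \<open>(0, 0)\<close>.\<close>
  have point: "Inl p \<rightarrow>\<^sup>*\<^bsub>G\<^esub> Inl origin \<and> Inl origin \<rightarrow>\<^sup>*\<^bsub>G\<^esub> Inl p" if p: "p \<in> P" for p
  proof -
    obtain x y where xy: "coord p = (x, y)" "x \<in> carrier S" "y \<in> carrier S"
      using coord_closed[OF p] by auto
    obtain l where l: "l \<in> P" "coord l = (\<zero>, \<ominus> y)"
      using ex_coord[of "(\<zero>, \<ominus> y)"] xy by auto
    obtain p' where p': "p' \<in> P" "coord p' = (\<one>, y)"
      using ex_coord[of "(\<one>, y)"] xy one_closed by auto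
    obtain l' where l': "l' \<in> P" "coord l' = (y, \<zero>)"
      using ex_coord[of "(y, \<zero>)"] xy by auto
    have "(p, l) \<in> R" "(p', l) \<in> R" "(p', l') \<in> R" "(origin, l') \<in> R"
      using p xy l p' l' origin one_closed
      by (auto simp: R_def incident_def r_neg mult_zero zero_mult l_one)
    then have "(Inl p, Inr l) \<in> parcs G" "(Inr l, Inl p') \<in> parcs G" "(Inl p', Inr l') \<in> parcs G" "(Inr l', Inl origin) \<in> parcs G"
      "(Inl origin, Inr l') \<in> parcs G" "(Inr l', Inl p') \<in> parcs G" "(Inl p', Inr l) \<in> parcs G" "(Inr l, Inl p) \<in> parcs G"
      using arc by auto
    then show ?thesis by (meson reachable_adjI reachable_trans)
  qed
  have line: "Inr l \<rightarrow>\<^sup>*\<^bsub>G\<^esub> Inl origin \<and> Inl origin \<rightarrow>\<^sup>*\<^bsub>G\<^esub> Inr l" if l: "l \<in> P" for l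
  proof -
    \<comment> \<open>One edge, here that of color \<open>\<zero>\<close>, leads from the line to a
      point, where the path found above takes over.\<close>
    have R: "(neighbor \<zero> l, l) \<in> R" and n: "neighbor \<zero> l \<in> P"
      using neighbor_iff[of \<zero> l "neighbor \<zero> l"] l R_sym neighbor_closed by auto
    then have "(Inr l, Inl (neighbor \<zero> l)) \<in> parcs G" "(Inl (neighbor \<zero> l), Inr l) \<in> parcs G"
      using arc by auto
    then show ?thesis using point[OF n] by (meson reachable_adjI reachable_trans)
  qed
  have "strongly_connected (with_proj G)"
  proof (rule strongly_connectedI)
    show "verts (with_proj G) \<noteq> {}" using origin verts by auto
    fix u v assume "u \<in> verts (with_proj G)" "v \<in> verts (with_proj G)"
    then have "u \<rightarrow>\<^sup>*\<^bsub>G\<^esub> Inl origin" "Inl origin \<rightarrow>\<^sup>*\<^bsub>G\<^esub> v"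
      using point line by (auto simp: verts)
    then show "u \<rightarrow>\<^sup>*\<^bsub>G\<^esub> v" by (rule reachable_trans)
  qed
  then show ?thesis by (simp add: connected_def G_def)
qed

lemma card_lines_through:
  assumes "p \<in> P"
  shows "card {l \<in> P. (p, l) \<in> R} = card (carrier S)"
proof -
  have "{v \<in> plane. incident (coord p) v} = coord ` {l \<in> P. (p, l) \<in> R}"
    unfolding bij_betw_imp_surj_on[OF coord, symmetric] using assms by (auto simp: R_def)
  moreover have "inj_on coord {l \<in> P. (p, l) \<in> R}"
    by (rule inj_onI) (simp add: coord_eq_iff)
  ultimately have "card {v \<in> plane. incident (coord p) v} = card {l \<in> P. (p, l) \<in> R}"
    by (simp add: card_image)
  then show ?thesis using card_incident[OF coord_closed[OF assms]] by simp
qed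

theorem colored_configuration: "colored_configuration (card (carrier S)) P P R edge_color"
proof
  show "finite P"
    using coord finite_carrier by (auto simp: bij_betw_finite)
  show "R \<subseteq> P \<times> P" by (auto simp: R_def)
  show "\<not> (\<exists>p\<^sub>1\<in>P. \<exists>p\<^sub>2\<in>P. \<exists>l\<^sub>1\<in>P. \<exists>l\<^sub>2\<in>P. p\<^sub>1 \<noteq> p\<^sub>2 \<and> l\<^sub>1 \<noteq> l\<^sub>2 \<and>
      (p\<^sub>1, l\<^sub>1) \<in> R \<and> (p\<^sub>1, l\<^sub>2) \<in> R \<and> (p\<^sub>2, l\<^sub>1) \<in> R \<and> (p\<^sub>2, l\<^sub>2) \<in> R)"
  proof clarify
    fix p p' l l'
    assume P: "p \<in> P" "p' \<in> P" "l \<in> P" "l' \<in> P"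
      and R: "(p, l) \<in> R" "(p, l') \<in> R" "(p', l) \<in> R" "(p', l') \<in> R"
      and ne: "p \<noteq> p'" "l \<noteq> l'"
    have "coord p = coord p' \<or> coord l = coord l'"
      using P R by (intro incident_no_digon coord_closed) (auto simp: R_def)
    then show False using P ne by (simp add: coord_eq_iff)
  qed
  show "card {l \<in> P. (p, l) \<in> R} = card (carrier S)" if "p \<in> P" for p
    using that by (rule card_lines_through)
  \<comment> \<open>Dual to the count of lines through a point, since \<open>R\<close> is
    symmetric.\<close>
  show "card {p \<in> P. (p, l) \<in> R} = card (carrier S)" if "l \<in> P" for l
    using card_lines_through[OF that] R_sym by simp
qed (rule connected_incidence_graph edge_coloring_edge_color six_cycle_edge_color)+

end

theorem theorem7p3:
  fixes F :: "('a, 'm) ring_scheme" and q :: nat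
  assumes "commutative_semifield F"
    and "finite (carrier F)"
    and "card (carrier F) = q"
  shows "\<exists>(P :: nat set) (L :: nat set) R c.
    colored_configuration q P L R c \<and> card P = q ^ 2 \<and> card L = q ^ 2"
proof -
  obtain color where color: "bij_betw color (carrier F) {..<q}"
    using ex_bij_betw_finite_nat[OF assms(2)] assms(3) by (auto simp: atLeast0LessThan)
  \<comment> \<open>The plane has \<open>q ^ 2\<close> elements, so its elements can be numbered
    below \<open>q ^ 2\<close>; this initial segment serves as both \<open>P\<close> and
    \<open>L\<close>.\<close>
  obtain coord where coord: "bij_betw coord {..<q ^ 2} (carrier F \<times> carrier F)"
    using ex_bij_betw_nat_finite[of "carrier F \<times> carrier F"] assms(2,3)
    by (auto simp: atLeast0LessThan card_cartesian_product power2_eq_square)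
  interpret coordinatized_semifield F "{..<q ^ 2}" coord color
    using assms coord color
    by (simp add: coordinatized_semifield_def coordinatized_semifield_axioms_def)
  show ?thesis
    using colored_configuration assms(3) by (metis card_lessThan)
qed

end
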